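(* Let $n$ be a positive integer and let $A=(A,\cdot,\circ)$ be a brace whose multiplicative group $(A,\circ)$ is isomorphic to $\mathbb{Z}^n$. Then $A$ is right nilpotent of class at most $n$.
   Context: A skew brace (meaning skew left brace) is a set $A$ with two group structures $(A,\cdot)$ (the additive group) and $(A,\circ)$ (the multiplicative group) such that $a\circ(b\cdot c)=(a\circ b)\cdot a^{-1}\cdot(a\circ c)$ for all $a,b,c\in A$, where $a^{-1}$ is the inverse of $a$ in $(A,\cdot)$. The two groups have the same neutral element, denoted $1$. A brace is a skew brace whose additive group $(A,\cdot)$ is abelian. For $a,b\in A$ put $a*b=a^{-1}\cdot(a\circ b)\cdot b^{-1}$. For subsets $X,Y\subseteq A$, $X*Y$ is the subgroup of $(A,\cdot)$ generated by $\{x*y\mid x\in X,\ y\in Y\}$. Set $A^{(1)}=A$ and $A^{(m)}=A^{(m-1)}*A$ for $m\ge2$. The skew brace $A$ is right nilpotent if $A^{(m)}=\{1\}$ for some $m\ge1$; if $m$ is minimal with this property, $m-1$ is called the right nilpotency class of $A$. *)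

theory Defs
  imports "HOL-Algebra.Generated_Groups" "HOL-Algebra.Product_Groups"
begin

text \<open>A skew (left) brace is a pair of group structures \<open>P\<close> (additive) and \<open>M\<close>
  (multiplicative) on a common carrier. Equality of the neutral elements is a consequence
  of the axioms, see \<open>one_eq\<close> below.\<close>

locale skew_brace = additive: group P + multiplicative: group M
  for P :: "('a, 'b) monoid_scheme" and M :: "('a, 'c) monoid_scheme" +
  assumes carrier_eq: "carrier M = carrier P"
    and brace_distrib: "\<lbrakk>a \<in> carrier P; b \<in> carrier P; c \<in> carrier P\<rbrakk> \<Longrightarrow>
      a \<otimes>\<^bsub>M\<^esub> (b \<otimes>\<^bsub>P\<^esub> c) = (a \<otimes>\<^bsub>M\<^esub> b) \<otimes>\<^bsub>P\<^esub> inv\<^bsub>P\<^esub> a \<otimes>\<^bsub>P\<^esub> (a \<otimes>\<^bsub>M\<^esub> c)"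

locale brace = skew_brace P M + additive: comm_group P
  for P :: "('a, 'b) monoid_scheme" and M :: "('a, 'c) monoid_scheme"

lemma (in skew_brace) one_eq: "\<one>\<^bsub>M\<^esub> = \<one>\<^bsub>P\<^esub>"
proof -
  let ?x = "\<one>\<^bsub>M\<^esub>"
  have x: "?x \<in> carrier P"
    using carrier_eq multiplicative.one_closed by simp
  have "?x \<otimes>\<^bsub>M\<^esub> (\<one>\<^bsub>P\<^esub> \<otimes>\<^bsub>P\<^esub> \<one>\<^bsub>P\<^esub>)
      = (?x \<otimes>\<^bsub>M\<^esub> \<one>\<^bsub>P\<^esub>) \<otimes>\<^bsub>P\<^esub> inv\<^bsub>P\<^esub> ?x \<otimes>\<^bsub>P\<^esub> (?x \<otimes>\<^bsub>M\<^esub> \<one>\<^bsub>P\<^esub>)"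
    using x by (intro brace_distrib) auto
  then have "\<one>\<^bsub>P\<^esub> = inv\<^bsub>P\<^esub> ?x"
    using x by (simp add: carrier_eq)
  then show ?thesis
    using x by (metis additive.inv_inv additive.inv_one)
qed

definition brace_star :: "('a, 'b) monoid_scheme \<Rightarrow> ('a, 'c) monoid_scheme \<Rightarrow> 'a \<Rightarrow> 'a \<Rightarrow> 'a"
  where "brace_star P M a b = inv\<^bsub>P\<^esub> a \<otimes>\<^bsub>P\<^esub> (a \<otimes>\<^bsub>M\<^esub> b) \<otimes>\<^bsub>P\<^esub> inv\<^bsub>P\<^esub> b"

definition brace_star_set ::
  "('a, 'b) monoid_scheme \<Rightarrow> ('a, 'c) monoid_scheme \<Rightarrow> 'a set \<Rightarrow> 'a set \<Rightarrow> 'a set"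
  where "brace_star_set P M X Y = generate P {brace_star P M x y |x y. x \<in> X \<and> y \<in> Y}"

text \<open>The series \<open>A\<^sup>(\<^sup>m\<^sup>)\<close> starts at \<open>m = 1\<close>; the value at \<open>0\<close> is a dummy.\<close>

fun right_series :: "('a, 'b) monoid_scheme \<Rightarrow> ('a, 'c) monoid_scheme \<Rightarrow> nat \<Rightarrow> 'a set"
  where
    "right_series P M 0 = carrier P"
  | "right_series P M (Suc 0) = carrier P"
  | "right_series P M (Suc (Suc m)) =
       brace_star_set P M (right_series P M (Suc m)) (carrier P)"

definition right_nilpotent :: "('a, 'b) monoid_scheme \<Rightarrow> ('a, 'c) monoid_scheme \<Rightarrow> bool"
  where "right_nilpotent P M \<longleftrightarrow> (\<exists>m\<ge>1. right_series P M m = {\<one>\<^bsub>P\<^esub>})"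

text \<open>Only meaningful for right nilpotent skew braces.\<close>

definition right_nilpotency_class :: "('a, 'b) monoid_scheme \<Rightarrow> ('a, 'c) monoid_scheme \<Rightarrow> nat"
  where "right_nilpotency_class P M = (LEAST m. m \<ge> 1 \<and> right_series P M m = {\<one>\<^bsub>P\<^esub>}) - 1"

end

theory Submission
  imports Defs "HOL-Algebra.FiniteProduct" "HOL-Computational_Algebra.Primes"
begin

text \<open>
  A brace with abelian multiplicative group is a commutative radical ring: under \<open>+\<close> (the
  additive group) and \<open>*\<close> it is a commutative ring without unit in which every
  \<open>1 + a\<close>, formed in the ring with an adjoined unit, is invertible, and
  \<open>1 + (a \<circ> b) = (1 + a) (1 + b)\<close>. The terms of the right series are then the powers of
  this ring \<open>R\<close>, and \<open>R\<^sup>n\<^sup>+\<^sup>1 = 0\<close> is to be shown. In the formal text the three operations are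
  \<open>\<boxplus>\<close>, \<open>\<star>\<close> and \<open>\<odot>\<close>; an element \<open>a\<close> of the multiplicative group stands for \<open>1 + a\<close>.

  The group \<open>\<int>\<^sup>n\<close> enters through two properties only: it is torsion-free, and any
  \<open>n + 1\<close> of its elements satisfy a nontrivial multiplicative relation. The proof consists in
  writing down suitable elements and evaluating the relation between them.

  The main observation (\<open>leading_term_of_relation\<close>) concerns a relation in which the powers of
  \<open>1 + a\<^sub>i\<close> with exponents \<open>e\<^sub>i\<close> multiply to 1. If all of these powers but the one with index
  \<open>j\<close> are congruent to 1 modulo \<open>y R\<close>, where \<open>y = a\<^sub>j\<close>, then expanding the product modulo \<open>y R\<close>
  leaves \<open>e\<^sub>j y \<in> y R\<close>. So an integer acts on \<open>y\<close> as an element \<open>u\<close> of the radical, and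
  \<open>y = 0\<close> follows in two situations.

  \<^item> If \<open>p y = 0\<close> for a prime \<open>p\<close> that does not divide \<open>e\<^sub>j\<close>, then \<open>y\<close> itself lies in \<open>y R\<close>,
    so \<open>y = 0\<close> as in Nakayama's lemma. With suitable powers of \<open>z\<close> as the \<open>a\<^sub>i\<close>, every \<open>z\<close> with
    \<open>p z = 0\<close> is therefore nilpotent; then \<open>(1 + z\<^sup>k)\<^sup>p = 1\<close> for the last nonzero power
    \<open>z\<^sup>k\<close>, against torsion-freeness. Hence \<open>R\<close> has no additive torsion
    (\<open>no_prime_torsion\<close>, \<open>additive_torsion_free\<close>).

  \<^item> In general, let \<open>c y = y u\<close> with \<open>c > 0\<close> (\<open>integer_multiple_in_radical\<close>). The integer
    \<open>1 + k c\<close> acts on \<open>y\<close> as the group element \<open>1 + k u\<close>. A relation between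
    \<open>n + 1\<close> of these elements becomes an equation \<open>S y = T y\<close> between products of the integers
    \<open>1 + k c\<close>; these being chosen pairwise coprime, \<open>S \<noteq> T\<close>, and \<open>y = 0\<close> because
    \<open>R\<close> has no additive torsion.

  Finally let \<open>x\<^sub>0, \<dots>, x\<^sub>n \<in> R\<close> and take for \<open>a\<^sub>i\<close> the partial product \<open>x\<^sub>0 \<cdots> x\<^sub>i\<close>. In a relation
  between the \<open>1 + a\<^sub>i\<close>, let \<open>j\<close> be the least index with \<open>e\<^sub>j \<noteq> 0\<close>. The later \<open>a\<^sub>i\<close> are multiples of
  \<open>a\<^sub>j\<close>, so \<open>a\<^sub>j = 0\<close> by the above, and with it \<open>x\<^sub>0 \<cdots> x\<^sub>n = 0\<close> (\<open>star_prod_vanishes\<close>).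
\<close>

section \<open>Integer preliminaries\<close>

text \<open>Gaussian elimination without division: a vector whose last coordinate is nonzero is used to
  clear that coordinate from the others, which are scaled first.\<close>

lemma int_vectors_dependent:
  fixes v :: "'i \<Rightarrow> nat \<Rightarrow> int"
  assumes "finite I" and "card I > n"
  shows "\<exists>e. (\<exists>i\<in>I. e i \<noteq> 0) \<and> (\<forall>k<n. (\<Sum>i\<in>I. e i * v i k) = 0)"
  using assms
proof (induction n arbitrary: I v)
  case 0
  then have "I \<noteq> {}" by auto
  then show ?case by (intro exI[of _ "\<lambda>_. 1"]) auto
next
  case (Suc n)
  show ?case
  proof (cases "\<forall>i\<in>I. v i n = 0")
    case True
    obtain e where e: "\<exists>i\<in>I. e i \<noteq> 0" "\<forall>k<n. (\<Sum>i\<in>I. e i * v i k) = 0"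
      using Suc.IH[of I v] Suc.prems by auto
    have "(\<Sum>i\<in>I. e i * v i k) = 0" if "k < Suc n" for k
      using that e(2) True by (cases "k = n") (auto intro: sum.neutral)
    with e(1) show ?thesis by blast
  next
    case False
    then obtain i0 where i0: "i0 \<in> I" "v i0 n \<noteq> 0" by blast
    define a where "a = v i0 n"
    define J where "J = I - {i0}"
    define w where "w = (\<lambda>i k. a * v i k - v i n * v i0 k)"
    have J: "finite J" "card J > n" using Suc.prems i0 by (auto simp: J_def)
    obtain e where e: "\<exists>i\<in>J. e i \<noteq> 0" "\<forall>k<n. (\<Sum>i\<in>J. e i * w i k) = 0"
      using Suc.IH[OF J, of w] by auto
    define f where "f = (\<lambda>i. if i = i0 then - (\<Sum>l\<in>J. e l * v l n) else a * e i)"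
    have sum_f: "(\<Sum>i\<in>I. f i * v i k) = (\<Sum>i\<in>J. e i * w i k)" for k
    proof -
      have "(\<Sum>i\<in>I. f i * v i k) = f i0 * v i0 k + (\<Sum>i\<in>J. f i * v i k)"
        using Suc.prems i0 by (simp add: J_def sum.remove)
      also have "(\<Sum>i\<in>J. f i * v i k) = (\<Sum>i\<in>J. a * e i * v i k)"
        by (rule sum.cong) (auto simp: f_def J_def)
      also have "f i0 * v i0 k + \<dots> = (\<Sum>i\<in>J. a * e i * v i k - e i * v i n * v i0 k)"
        by (simp add: f_def sum_subtractf sum_distrib_right)
      also have "\<dots> = (\<Sum>i\<in>J. e i * w i k)"
        by (rule sum.cong) (auto simp: w_def algebra_simps)
      finally show ?thesis .
    qed
    have "(\<Sum>i\<in>I. f i * v i k) = 0" if "k < Suc n" for k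
    proof (cases "k = n")
      case True
      then show ?thesis unfolding sum_f by (auto simp: w_def a_def intro: sum.neutral)
    next
      case False
      then show ?thesis using that e(2) sum_f by simp
    qed
    moreover have "\<exists>i\<in>I. f i \<noteq> 0"
      using e(1) i0 by (auto simp: f_def J_def a_def)
    ultimately show ?thesis by blast
  qed
qed

text \<open>Goedel's sequence: a common divisor of two terms divides \<open>l - i\<close>, hence \<open>fact N\<close>, hence
  also 1. The factor \<open>c\<close> makes all terms congruent to 1 modulo \<open>c\<close>.\<close>

lemma coprime_beta_sequence:
  fixes c :: int
  assumes "i \<in> {1..N}" "l \<in> {1..N}" "i \<noteq> l"
  shows "coprime (1 + int i * (c * fact N)) (1 + int l * (c * fact N))"
proof (rule coprimeI)
  fix d assume d: "d dvd 1 + int i * (c * fact N)" "d dvd 1 + int l * (c * fact N)"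
  have "d dvd int l * (1 + int i * (c * fact N)) - int i * (1 + int l * (c * fact N))"
    using d by (intro dvd_diff dvd_mult)
  then have "d dvd int l - int i" by (simp add: algebra_simps)
  moreover have "int l - int i dvd fact N"
  proof -
    define q where "q = (if i < l then l - i else i - l)"
    have "q \<ge> 1" "q \<le> N" using assms by (auto simp: q_def)
    then have "q dvd fact N" by (simp add: dvd_fact)
    then have "int q dvd fact N" by (metis int_dvd_int_iff of_nat_fact)
    moreover have "int l - int i = int q \<or> int l - int i = - int q"
      by (auto simp: q_def)
    ultimately show ?thesis by (metis minus_dvd_iff)
  qed
  ultimately have "d dvd int i * (c * fact N)" by (meson dvd_mult dvd_trans)
  with d(1) show "is_unit d" by (simp add: dvd_add_left_iff)
qed

section \<open>Braces with abelian multiplicative group as radical rings\<close>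

locale comm_brace = brace P M + multiplicative: comm_group M
  for P :: "('a, 'b) monoid_scheme" and M :: "('a, 'c) monoid_scheme"
begin

abbreviation A where "A \<equiv> carrier P"
abbreviation zero ("\<zero>") where "\<zero> \<equiv> \<one>\<^bsub>P\<^esub>"
abbreviation plus (infixl "\<boxplus>" 65) where "a \<boxplus> b \<equiv> a \<otimes>\<^bsub>P\<^esub> b"
abbreviation neg ("\<boxminus> _" [81] 80) where "\<boxminus> a \<equiv> inv\<^bsub>P\<^esub> a"
abbreviation circ (infixl "\<odot>" 70) where "a \<odot> b \<equiv> a \<otimes>\<^bsub>M\<^esub> b"
abbreviation star (infixl "\<star>" 75) where "a \<star> b \<equiv> brace_star P M a b"
abbreviation scale :: "int \<Rightarrow> 'a \<Rightarrow> 'a" (infixr "\<cdot>" 78) where "k \<cdot> a \<equiv> a [^]\<^bsub>P\<^esub> k"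

declare carrier_eq [simp] one_eq [simp]

lemma circ_closed [simp]: "a \<in> A \<Longrightarrow> b \<in> A \<Longrightarrow> a \<odot> b \<in> A"
  using multiplicative.m_closed by simp

lemma circ_zero [simp]: "a \<in> A \<Longrightarrow> a \<odot> \<zero> = a"
  using multiplicative.r_one by simp

lemma star_closed [simp]: "a \<in> A \<Longrightarrow> b \<in> A \<Longrightarrow> a \<star> b \<in> A"
  by (simp add: brace_star_def)

lemma circ_eq:
  assumes "a \<in> A" "b \<in> A"
  shows "a \<odot> b = a \<boxplus> b \<boxplus> a \<star> b"
proof -
  have "a \<boxplus> b \<boxplus> a \<star> b = (a \<boxplus> \<boxminus> a) \<boxplus> (b \<boxplus> \<boxminus> b) \<boxplus> a \<odot> b"
    unfolding brace_star_def using assms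
    by (simp only: additive.m_ac additive.inv_closed circ_closed additive.m_closed)
  then show ?thesis using assms by simp
qed

lemma star_comm: "a \<in> A \<Longrightarrow> b \<in> A \<Longrightarrow> a \<star> b = b \<star> a"
  using multiplicative.m_comm[of a b] by (simp add: brace_star_def additive.m_ac)

lemma star_add:
  assumes "a \<in> A" "b \<in> A" "c \<in> A"
  shows "a \<star> (b \<boxplus> c) = a \<star> b \<boxplus> a \<star> c"
  using assms
  by (simp add: brace_star_def brace_distrib additive.inv_mult additive.m_ac)

lemma star_add_left:
  assumes "a \<in> A" "b \<in> A" "c \<in> A"
  shows "(b \<boxplus> c) \<star> a = b \<star> a \<boxplus> c \<star> a"
  using assms star_add[of a b c] by (simp add: star_comm)

text \<open>Both ways of bracketing a triple \<open>\<odot>\<close>-product expand to the same sum of lower terms, plus one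
  of the two sides.\<close>

lemma star_assoc:
  assumes "a \<in> A" "b \<in> A" "c \<in> A"
  shows "(a \<star> b) \<star> c = a \<star> (b \<star> c)"
proof -
  define s where "s = a \<boxplus> b \<boxplus> c \<boxplus> a \<star> b \<boxplus> a \<star> c \<boxplus> b \<star> c"
  have "s \<boxplus> (a \<star> b) \<star> c = (a \<odot> b) \<odot> c"
    using assms by (simp add: s_def circ_eq star_add star_add_left additive.m_ac)
  also have "\<dots> = a \<odot> (b \<odot> c)"
    using assms by (simp add: multiplicative.m_assoc)
  also have "\<dots> = s \<boxplus> a \<star> (b \<star> c)"
    using assms by (simp add: s_def circ_eq star_add star_add_left additive.m_ac)
  finally show ?thesis using assms by (simp add: s_def)
qed

lemma star_hom: "a \<in> A \<Longrightarrow> (\<lambda>b. a \<star> b) \<in> hom P P"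
  by (auto simp: hom_def star_add)

lemma star_group_hom: "a \<in> A \<Longrightarrow> group_hom P P (\<lambda>b. a \<star> b)"
  using star_hom by unfold_locales

lemma star_zero [simp]: "a \<in> A \<Longrightarrow> a \<star> \<zero> = \<zero>"
  using group_hom.hom_one[OF star_group_hom] .

lemma zero_star [simp]: "a \<in> A \<Longrightarrow> \<zero> \<star> a = \<zero>"
  using star_zero[of a] by (simp add: star_comm)

lemma star_neg: "a \<in> A \<Longrightarrow> b \<in> A \<Longrightarrow> a \<star> (\<boxminus> b) = \<boxminus> (a \<star> b)"
  using group_hom.hom_inv[OF star_group_hom] .

lemma star_scale: "a \<in> A \<Longrightarrow> b \<in> A \<Longrightarrow> a \<star> (k \<cdot> b) = k \<cdot> (a \<star> b)"
  using group_hom.hom_int_pow[OF star_group_hom, of a b k] by simp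

lemma scale_star: "a \<in> A \<Longrightarrow> b \<in> A \<Longrightarrow> (k \<cdot> a) \<star> b = k \<cdot> (a \<star> b)"
  using star_scale[of b a k] by (simp add: star_comm)

lemma mpow_closed [simp]: "a \<in> A \<Longrightarrow> a [^]\<^bsub>M\<^esub> (k::int) \<in> A"
  using multiplicative.int_pow_closed[of a k] by simp

lemma mnatpow_closed [simp]: "a \<in> A \<Longrightarrow> a [^]\<^bsub>M\<^esub> (k::nat) \<in> A"
  using multiplicative.nat_pow_closed[of a k] by simp

text \<open>The radical property: \<open>a (1 - u) = 0\<close>, and \<open>1 - u\<close> is invertible.\<close>

lemma eq_zero_of_eq_star:
  assumes "a \<in> A" "u \<in> A" "a = a \<star> u"
  shows "a = \<zero>"
proof -
  have "(\<boxminus> u) \<star> a = \<boxminus> a"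
    using assms by (metis star_comm star_neg additive.inv_closed)
  then have "(\<boxminus> u) \<odot> a = (\<boxminus> u) \<odot> \<zero>"
    using assms(1,2) by (simp add: circ_eq additive.m_assoc)
  then show ?thesis
    using assms(1,2) multiplicative.Units_l_cancel[of "\<boxminus> u" a "\<zero>"]
    by simp
qed

section \<open>Powers modulo ideals\<close>

definition ideal :: "'a set \<Rightarrow> bool" where
  "ideal K \<longleftrightarrow> subgroup K P \<and> (\<forall>k\<in>K. \<forall>a\<in>A. k \<star> a \<in> K)"

definition multiples :: "'a \<Rightarrow> 'a set" where
  "multiples y = (\<lambda>r. y \<star> r) ` A"

lemma ideal_zero: "ideal {\<zero>}"
  unfolding ideal_def using additive.triv_subgroup by auto

lemma ideal_multiples:
  assumes "y \<in> A"
  shows "ideal (multiples y)"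
proof -
  have "subgroup (multiples y) P"
    using group_hom.img_is_subgroup[OF star_group_hom[OF assms]] by (simp add: multiples_def)
  moreover have "k \<star> a \<in> multiples y" if "k \<in> multiples y" "a \<in> A" for k a
    using that assms by (auto simp: multiples_def star_assoc)
  ultimately show ?thesis by (simp add: ideal_def)
qed

context
  fixes K assumes K: "ideal K"
begin

lemma ideal_subset: "k \<in> K \<Longrightarrow> k \<in> A"
  using K subgroup.subset by (auto simp: ideal_def)

lemma ideal_add: "k \<in> K \<Longrightarrow> l \<in> K \<Longrightarrow> k \<boxplus> l \<in> K"
  using K subgroup.m_closed by (auto simp: ideal_def)

lemma ideal_neg: "k \<in> K \<Longrightarrow> \<boxminus> k \<in> K"
  using K subgroup.m_inv_closed by (auto simp: ideal_def)

lemma ideal_scale: "k \<in> K \<Longrightarrow> (e::int) \<cdot> k \<in> K"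
  using K additive.subgroup_int_pow_closed by (auto simp: ideal_def)

lemma ideal_zero_mem: "\<zero> \<in> K"
  using K subgroup.one_closed by (auto simp: ideal_def)

lemma ideal_star: "k \<in> K \<Longrightarrow> a \<in> A \<Longrightarrow> k \<star> a \<in> K"
  using K by (auto simp: ideal_def)

lemma ideal_star': "k \<in> K \<Longrightarrow> a \<in> A \<Longrightarrow> a \<star> k \<in> K"
  using ideal_star[of k a] star_comm[of a k] ideal_subset[of k] by simp

lemma ideal_circ: "k \<in> K \<Longrightarrow> l \<in> K \<Longrightarrow> k \<odot> l \<in> K"
  by (simp add: circ_eq ideal_subset ideal_add ideal_star)

lemma ideal_finprod:
  assumes "finite I" "\<And>i. i \<in> I \<Longrightarrow> f i \<in> K"
  shows "finprod M f I \<in> K"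
  using assms
proof (induction I)
  case empty
  have "finprod M f {} = \<zero>" using multiplicative.finprod_empty[of f] by simp
  then show ?case using ideal_zero_mem by simp
next
  case (insert i I)
  then have "finprod M f (insert i I) = f i \<odot> finprod M f I"
    by (intro multiplicative.finprod_insert) (auto simp: ideal_subset)
  with insert show ?case by (simp add: ideal_circ)
qed

text \<open>Only the constant and the linear term of \<open>(1 + y)\<^sup>e\<close> survive modulo an ideal that
  contains \<open>y\<^sup>2\<close>.\<close>

lemma natpow_cong_scale:
  assumes "y \<in> A" "y \<star> y \<in> K"
  shows "\<exists>k\<in>K. y [^]\<^bsub>M\<^esub> (e::nat) = int e \<cdot> y \<boxplus> k"
proof (induction e)
  case 0
  then show ?case using assms by (intro bexI[of _ "\<zero>"]) (auto simp: ideal_zero_mem)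
next
  case (Suc e)
  then obtain k where k: "k \<in> K" "y [^]\<^bsub>M\<^esub> e = int e \<cdot> y \<boxplus> k" by blast
  have kA: "k \<in> A" using k ideal_subset by blast
  define l where "l = k \<boxplus> (y \<star> (int e \<cdot> y) \<boxplus> y \<star> k)"
  have "l \<in> K"
    using assms k(1) by (simp add: l_def star_scale ideal_add ideal_star' ideal_scale)
  moreover have "y [^]\<^bsub>M\<^esub> Suc e = int (Suc e) \<cdot> y \<boxplus> l"
  proof -
    have "y [^]\<^bsub>M\<^esub> Suc e = (int e \<cdot> y \<boxplus> k) \<odot> y" using k by simp
    also have "\<dots> = y \<odot> (int e \<cdot> y \<boxplus> k)"
      using multiplicative.m_comm[of y "int e \<cdot> y \<boxplus> k"] assms kA by simp
    also have "\<dots> = y \<boxplus> int e \<cdot> y \<boxplus> l"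
      using assms kA by (simp add: circ_eq star_add additive.m_ac l_def)
    also have "y \<boxplus> int e \<cdot> y = int (Suc e) \<cdot> y"
      using assms additive.int_pow_mult[of y 1 "int e"] additive.int_pow_1[of y]
      by simp
    finally show ?thesis .
  qed
  ultimately show ?case by blast
qed

text \<open>For negative exponents, the \<open>\<odot>\<close>-inverse \<open>z\<close> of \<open>y\<close> satisfies \<open>z = - y - y z\<close>. This gives
  \<open>y z \<in> K\<close> and \<open>z\<^sup>2 \<in> K\<close>, so that \<open>z\<close> is congruent to \<open>- y\<close> and the previous lemma applies
  to \<open>z\<close>.\<close>

lemma pow_cong_scale:
  assumes "y \<in> A" "y \<star> y \<in> K"
  shows "\<exists>k\<in>K. y [^]\<^bsub>M\<^esub> (e::int) = e \<cdot> y \<boxplus> k"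
proof (cases "e \<ge> 0")
  case True
  then show ?thesis
    using natpow_cong_scale[OF assms, of "nat e"]
    by (metis int_nat_eq int_pow_int)
next
  case False
  define q where "q = nat (- e)"
  define z where "z = inv\<^bsub>M\<^esub> y"
  have z: "z \<in> A" using assms multiplicative.inv_closed[of y] by (simp add: z_def)
  have "y \<odot> z = \<zero>" using assms multiplicative.r_inv[of y] by (simp add: z_def)
  then have 0: "y \<boxplus> z \<boxplus> y \<star> z = \<zero>" using assms z by (simp add: circ_eq)
  then have z_eq: "z = \<boxminus> y \<boxplus> \<boxminus> (y \<star> z)"
    using assms z
    by (metis additive.inv_equality additive.inv_mult additive.m_closed additive.m_comm
        additive.m_assoc star_closed)
  have yz: "y \<star> z \<in> K"
  proof -
    have "y \<star> z = y \<star> (\<boxminus> y \<boxplus> \<boxminus> (y \<star> z))" using z_eq by simp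
    also have "\<dots> = \<boxminus> (y \<star> y) \<boxplus> \<boxminus> ((y \<star> y) \<star> z)"
      using assms z by (simp add: star_add star_neg star_assoc)
    finally show ?thesis using assms z by (simp add: ideal_add ideal_neg ideal_star)
  qed
  have zz: "z \<star> z \<in> K"
  proof -
    have "z \<star> z = z \<star> (\<boxminus> y \<boxplus> \<boxminus> (y \<star> z))" using z_eq by simp
    also have "\<dots> = \<boxminus> (y \<star> z) \<boxplus> \<boxminus> (z \<star> (y \<star> z))"
      using assms z by (simp add: star_add star_neg star_comm)
    finally show ?thesis using z yz by (simp add: ideal_add ideal_neg ideal_star')
  qed
  obtain k where k: "k \<in> K" "z [^]\<^bsub>M\<^esub> q = int q \<cdot> z \<boxplus> k"
    using natpow_cong_scale[OF z zz, of q] by blast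
  have kA: "k \<in> A" using k ideal_subset by blast
  define l where "l = int q \<cdot> (\<boxminus> (y \<star> z)) \<boxplus> k"
  have e: "e = - int q" using False by (simp add: q_def)
  have "y [^]\<^bsub>M\<^esub> e = z [^]\<^bsub>M\<^esub> q"
    using assms by (simp add: e z_def multiplicative.int_pow_neg_int multiplicative.nat_pow_inv)
  also have "\<dots> = int q \<cdot> (\<boxminus> y \<boxplus> \<boxminus> (y \<star> z)) \<boxplus> k" using k z_eq by simp
  also have "\<dots> = int q \<cdot> (\<boxminus> y) \<boxplus> l"
    using assms z kA by (simp only: l_def additive.int_pow_distrib additive.inv_closed star_closed
       additive.int_pow_closed additive.m_assoc)
  also have "int q \<cdot> (\<boxminus> y) = e \<cdot> y"
    using assms by (simp add: e additive.int_pow_inv additive.int_pow_neg)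
  finally have "y [^]\<^bsub>M\<^esub> e = e \<cdot> y \<boxplus> l" .
  moreover have "l \<in> K"
    using yz k(1) by (simp add: l_def ideal_add ideal_neg ideal_scale)
  ultimately show ?thesis by blast
qed

lemma pow_mem_ideal:
  assumes "y \<in> A" "y \<star> y \<in> K" "e \<cdot> y \<in> K"
  shows "y [^]\<^bsub>M\<^esub> (e::int) \<in> K"
  using pow_cong_scale[OF assms(1,2), of e] assms(3) by (auto intro: ideal_add)

end

section \<open>The leading term of a multiplicative relation\<close>

text \<open>Modulo \<open>K = multiples (a j)\<close>, the factors with \<open>i \<noteq> j\<close> are trivial by assumption, and the
  remaining one is congruent to \<open>e j \<cdot> a j\<close>, since \<open>K\<close> contains the square of \<open>a j\<close>.
  So \<open>e j \<cdot> a j\<close> lies in \<open>K\<close>.\<close>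

lemma leading_term_of_relation:
  assumes "finite I" "j \<in> I" "\<And>i. i \<in> I \<Longrightarrow> a i \<in> A"
    and others: "\<And>i. i \<in> I \<Longrightarrow> i \<noteq> j \<Longrightarrow> a i [^]\<^bsub>M\<^esub> (e i :: int) \<in> multiples (a j)"
    and rel: "finprod M (\<lambda>i. a i [^]\<^bsub>M\<^esub> e i) I = \<zero>"
  shows "\<exists>u\<in>A. e j \<cdot> a j = a j \<star> u"
proof -
  let ?y = "a j" and ?K = "multiples (a j)"
  have y: "?y \<in> A" using assms by blast
  note K = ideal_multiples[OF y]
  define r where "r = finprod M (\<lambda>i. a i [^]\<^bsub>M\<^esub> e i) (I - {j})"
  have r: "r \<in> ?K" unfolding r_def by (rule ideal_finprod[OF K]) (use assms(1) others in auto)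
  have "?y \<star> ?y \<in> ?K" using y by (auto simp: multiples_def)
  then obtain k where k: "k \<in> ?K" "?y [^]\<^bsub>M\<^esub> e j = e j \<cdot> ?y \<boxplus> k"
    using pow_cong_scale[OF K y] by blast
  have rA: "r \<in> A" and kA: "k \<in> A" using ideal_subset[OF K] r k by auto
  have "finprod M (\<lambda>i. a i [^]\<^bsub>M\<^esub> e i) (insert j (I - {j})) = ?y [^]\<^bsub>M\<^esub> e j \<odot> r"
    unfolding r_def using assms by (intro multiplicative.finprod_insert) auto
  then have "(e j \<cdot> ?y \<boxplus> k) \<odot> r = \<zero>"
    using rel assms(2) k by (simp add: insert_absorb)
  then have 0: "e j \<cdot> ?y \<boxplus> (k \<boxplus> r \<boxplus> (e j \<cdot> ?y \<boxplus> k) \<star> r) = \<zero>"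
    using y rA kA by (simp add: circ_eq additive.m_assoc)
  define l where "l = k \<boxplus> r \<boxplus> (e j \<cdot> ?y \<boxplus> k) \<star> r"
  have "l \<in> ?K" using k(1) r y kA
    by (auto simp: l_def intro!: ideal_add[OF K] ideal_star'[OF K])
  moreover have "e j \<cdot> ?y = \<boxminus> l"
    using 0 y ideal_subset[OF K \<open>l \<in> ?K\<close>] unfolding l_def[symmetric]
    by (metis additive.inv_equality additive.int_pow_closed)
  ultimately have "e j \<cdot> ?y \<in> ?K" using ideal_neg[OF K] by simp
  then show ?thesis by (auto simp: multiples_def)
qed

section \<open>Iterated products and the right series\<close>

text \<open>The value at \<open>k\<close> is a product of \<open>k + 1\<close> factors; in particular \<open>star_prod (\<lambda>_. z) k\<close> is the
  ring power of \<open>z\<close> with exponent \<open>k + 1\<close>.\<close>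

fun star_prod :: "(nat \<Rightarrow> 'a) \<Rightarrow> nat \<Rightarrow> 'a" where
  "star_prod x 0 = x 0"
| "star_prod x (Suc k) = star_prod x k \<star> x (Suc k)"

lemma star_prod_closed [simp]: "(\<And>i. x i \<in> A) \<Longrightarrow> star_prod x k \<in> A"
  by (induction k) auto

lemma star_prod_multiple:
  assumes "\<And>i. x i \<in> A" "i < k"
  shows "star_prod x k \<in> multiples (star_prod x i)"
  using assms(2)
proof (induction k)
  case (Suc k)
  then show ?case
    using assms(1) ideal_star[OF ideal_multiples, of "star_prod x i" "star_prod x k" "x (Suc k)"]
    by (cases "i = k") (auto simp: multiples_def)
qed simp

lemma star_prod_const_mult:
  assumes "z \<in> A"
  shows "star_prod (\<lambda>_. z) i \<star> star_prod (\<lambda>_. z) k = star_prod (\<lambda>_. z) (i + k + 1)"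
  using assms by (induction k) (simp_all flip: star_assoc)

text \<open>As \<open>\<star>\<close> is additive on the left, multiplying a sum of products by one more factor gives a sum
  of longer products.\<close>

lemma right_series_star_prod:
  "right_series P M (Suc m) \<subseteq> generate P {star_prod x m | x. \<forall>i. x i \<in> A}"
proof (induction m)
  case 0
  have "a \<in> generate P {star_prod x 0 | x. \<forall>i. x i \<in> A}" if "a \<in> A" for a
    using that by (intro generate.incl CollectI exI[of _ "\<lambda>_. a"]) auto
  then show ?case by auto
next
  case (Suc m)
  let ?S = "\<lambda>m. {star_prod x m | x. \<forall>i. x i \<in> A}"
  have SA: "?S m \<subseteq> A" for m by auto
  have sub: "subgroup (generate P (?S (Suc m))) P"
    using additive.generate_is_subgroup SA by blast
  have gen: "star_prod x m \<star> y \<in> ?S (Suc m)" if "\<forall>i. x i \<in> A" "y \<in> A" for x y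
  proof -
    \<comment> \<open>Only the first \<open>m + 1\<close> entries of \<open>x\<close> matter, so the next one may be set to \<open>y\<close>.\<close>
    let ?x = "x (Suc m := y)"
    have "star_prod ?x k = star_prod x k" if "k \<le> m" for k
      using that by (induction k) auto
    then have "star_prod ?x (Suc m) = star_prod x m \<star> y" by simp
    then show ?thesis using that by (intro CollectI exI[of _ ?x]) auto
  qed
  have *: "a \<star> y \<in> generate P (?S (Suc m))" if "a \<in> generate P (?S m)" "y \<in> A" for a y
    using that(1)
  proof (induction a rule: generate.induct)
    case one
    then show ?case using that(2) by (simp add: generate.one)
  next
    case (incl h)
    then show ?case using gen that(2) by (blast intro: generate.incl)
  next
    case (inv h)
    then have h: "h \<in> A" "h \<star> y \<in> ?S (Suc m)" using gen that(2) by auto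
    then have "(\<boxminus> h) \<star> y = \<boxminus> (h \<star> y)"
      using that(2) by (metis star_comm star_neg additive.inv_closed)
    then show ?case using generate.inv[OF h(2), of P] by simp
  next
    case (eng h1 h2)
    have "h1 \<in> A" "h2 \<in> A" using eng additive.generate_in_carrier[OF SA] by auto
    then have "(h1 \<boxplus> h2) \<star> y = h1 \<star> y \<boxplus> h2 \<star> y" using that(2) by (simp add: star_add_left)
    then show ?case using eng.IH by (simp add: generate.eng)
  qed
  have "{x \<star> y |x y. x \<in> right_series P M (Suc m) \<and> y \<in> A} \<subseteq> generate P (?S (Suc m))"
    using * Suc by blast
  then have "generate P {x \<star> y |x y. x \<in> right_series P M (Suc m) \<and> y \<in> A}
      \<subseteq> generate P (?S (Suc m))"
    using additive.generate_subgroup_incl sub by blast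
  then show ?case by (simp add: brace_star_set_def)
qed

section \<open>Group elements acting as integers\<close>

text \<open>The action of \<open>1 + g\<close> on \<open>y\<close> is \<open>y \<boxplus> g \<star> y\<close>. It turns \<open>\<odot>\<close> into composition, so elements
  that scale \<open>y\<close> by integers do so multiplicatively.\<close>

lemma finprod_acts_as_integer:
  assumes "finite I" "y \<in> A" "\<And>i. i \<in> I \<Longrightarrow> g i \<in> A"
    and "\<And>i. i \<in> I \<Longrightarrow> y \<boxplus> g i \<star> y = m i \<cdot> y"
  shows "y \<boxplus> finprod M g I \<star> y = prod m I \<cdot> y"
  using assms(1,3,4)
proof (induction I)
  case empty
  then show ?case using assms(2) by (simp add: additive.int_pow_1)
next
  case (insert i I)
  define h where "h = finprod M g I"
  have h: "h \<in> A"
    using multiplicative.finprod_closed[of g I] insert by (auto simp: h_def)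
  have IH: "y \<boxplus> h \<star> y = prod m I \<cdot> y" using insert by (simp add: h_def)
  have i: "g i \<in> A" "y \<boxplus> g i \<star> y = m i \<cdot> y" using insert by auto
  have "finprod M g (insert i I) = g i \<odot> h"
    unfolding h_def using insert by (intro multiplicative.finprod_insert) auto
  then have "y \<boxplus> finprod M g (insert i I) \<star> y
      = (y \<boxplus> h \<star> y) \<boxplus> g i \<star> (y \<boxplus> h \<star> y)"
    using i(1) h assms(2)
    by (simp add: circ_eq star_add star_add_left star_assoc additive.m_ac)
  also have "\<dots> = prod m I \<cdot> (y \<boxplus> g i \<star> y)"
    using i(1) assms(2) by (simp add: IH star_scale additive.int_pow_distrib)
  also have "\<dots> = prod m (insert i I) \<cdot> y"
    using insert(1,2) assms(2) i(2) by (simp add: additive.int_pow_pow mult.commute)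
  finally show ?case .
qed

lemma natpow_acts_as_integer:
  assumes "y \<in> A" "g \<in> A" "y \<boxplus> g \<star> y = m \<cdot> y"
  shows "y \<boxplus> (g [^]\<^bsub>M\<^esub> (k::nat)) \<star> y = (m ^ k) \<cdot> y"
  using finprod_acts_as_integer[of "{..<k}" y "\<lambda>_. g" "\<lambda>_. m"] assms
  by (simp add: multiplicative.finprod_const)

end

section \<open>Torsion-free multiplicative group of finite rank\<close>

locale finite_rank_brace = comm_brace +
  fixes n :: nat
  assumes dependent: "\<lbrakk>finite (I :: nat set); card I > n; \<And>i. i \<in> I \<Longrightarrow> a i \<in> carrier P\<rbrakk> \<Longrightarrow>
      \<exists>e :: nat \<Rightarrow> int. (\<exists>i\<in>I. e i \<noteq> 0) \<and> finprod M (\<lambda>i. a i [^]\<^bsub>M\<^esub> e i) I = \<one>\<^bsub>P\<^esub>"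
    and torsion_free: "\<lbrakk>x \<in> carrier P; x [^]\<^bsub>M\<^esub> (d::int) = \<one>\<^bsub>P\<^esub>; d \<noteq> 0\<rbrakk> \<Longrightarrow> x = \<one>\<^bsub>P\<^esub>"
begin

text \<open>Torsion-freeness permits dividing the exponents of a relation by their greatest common
  divisor.\<close>

lemma primitive_relation:
  assumes "finite (I :: nat set)" "card I > n" and aA: "\<And>i. i \<in> I \<Longrightarrow> a i \<in> A"
    and p: "prime (p::int)"
  shows "\<exists>e :: nat \<Rightarrow> int. (\<exists>i\<in>I. \<not> p dvd e i) \<and> finprod M (\<lambda>i. a i [^]\<^bsub>M\<^esub> e i) I = \<zero>"
proof -
  obtain e :: "nat \<Rightarrow> int" where e: "\<exists>i\<in>I. e i \<noteq> 0"
      "finprod M (\<lambda>i. a i [^]\<^bsub>M\<^esub> e i) I = \<zero>"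
    using dependent[OF assms(1,2), of a] aA by auto
  define g where "g = Gcd (e ` I)"
  have g0: "g \<noteq> 0" using e(1) by (auto simp: g_def Gcd_0_iff)
  define f where "f = (\<lambda>i. e i div g)"
  have ef: "e i = f i * g" if "i \<in> I" for i
    using that by (simp add: f_def g_def Gcd_dvd)
  define h where "h = finprod M (\<lambda>i. a i [^]\<^bsub>M\<^esub> f i) I"
  have hA: "h \<in> A"
    using multiplicative.finprod_closed[of "\<lambda>i. a i [^]\<^bsub>M\<^esub> f i" I] aA by (auto simp: h_def)
  have "finprod M (\<lambda>i. a i [^]\<^bsub>M\<^esub> e i) J = finprod M (\<lambda>i. a i [^]\<^bsub>M\<^esub> f i) J [^]\<^bsub>M\<^esub> g"
    if "J \<subseteq> I" for J
    using finite_subset[OF that assms(1)] that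
  proof (induction J)
    case empty
    then show ?case using multiplicative.int_pow_one[of g] by simp
  next
    case (insert j J)
    have pi: "(\<lambda>i. a i [^]\<^bsub>M\<^esub> (k i::int)) \<in> J \<rightarrow> carrier M" for k using insert aA by auto
    have *: "finprod M (\<lambda>i. a i [^]\<^bsub>M\<^esub> (k i::int)) (insert j J)
        = a j [^]\<^bsub>M\<^esub> k j \<odot> finprod M (\<lambda>i. a i [^]\<^bsub>M\<^esub> k i) J" for k
      using insert aA pi by (intro multiplicative.finprod_insert) auto
    have "a j [^]\<^bsub>M\<^esub> e j = (a j [^]\<^bsub>M\<^esub> f j) [^]\<^bsub>M\<^esub> g"
      using insert.prems aA by (simp add: ef multiplicative.int_pow_pow)
    with insert * show ?case
      using multiplicative.int_pow_distrib[of "a j [^]\<^bsub>M\<^esub> f j"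
          "finprod M (\<lambda>i. a i [^]\<^bsub>M\<^esub> f i) J" g] aA multiplicative.finprod_closed[OF pi]
      by simp
  qed
  then have "h [^]\<^bsub>M\<^esub> g = \<zero>" using e(2) by (simp add: h_def)
  then have "h = \<zero>" using torsion_free hA g0 by blast
  moreover have "\<exists>i\<in>I. \<not> p dvd f i"
  proof (rule ccontr)
    assume "\<not> ?thesis"
    then have "p * g dvd e i" if "i \<in> I" for i using that by (simp add: ef mult_dvd_mono)
    then have "p * g dvd g" unfolding g_def by (intro Gcd_greatest) auto
    then have "p dvd 1" using g0 by (simp add: dvd_mult_cancel_right)
    then show False using p not_prime_unit by blast
  qed
  ultimately show ?thesis unfolding h_def by blast
qed

text \<open>As \<open>a\<^sup>2 = 0\<close>, the power \<open>(1 + a)\<^sup>p\<close> equals \<open>1 + p a = 1\<close>, and the multiplicative group is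
  torsion-free.\<close>

lemma square_zero_torsion_trivial:
  assumes "a \<in> A" "p \<cdot> a = \<zero>" "p \<noteq> 0" "a \<star> a = \<zero>"
  shows "a = \<zero>"
proof -
  have "a [^]\<^bsub>M\<^esub> p = p \<cdot> a"
    using pow_cong_scale[OF ideal_zero assms(1), of p] assms by auto
  then show ?thesis using torsion_free assms by simp
qed

text \<open>The relation is taken between \<open>1 + z\<^sup>n\<^sup>+\<^sup>1, \<dots>, 1 + z\<^sup>2\<^sup>n\<^sup>+\<^sup>1\<close>. In this range the square of
  each power is a multiple of all of them, so \<open>(1 + z\<^sup>i)\<^sup>e\<close> is congruent to
  \<open>1 + e z\<^sup>i\<close> modulo all the ideals involved. Factors whose exponent is divisible by \<open>p\<close> then
  drop out, and the least remaining index gives the leading term.\<close>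

lemma no_prime_torsion:
  assumes z: "z \<in> A" and pz: "p \<cdot> z = \<zero>" and p: "prime (p::int)"
  shows "z = \<zero>"
proof -
  let ?z = "star_prod (\<lambda>_. z)"
  have zA: "?z i \<in> A" for i using z by simp
  have pz': "p \<cdot> ?z i = \<zero>" for i
  proof (cases i)
    case (Suc k)
    then show ?thesis using z pz zA star_scale[of "?z k" z p] by simp
  qed (use pz in simp)
  obtain e :: "nat \<Rightarrow> int" where e: "\<exists>i\<in>{n..2*n}. \<not> p dvd e i"
      and rel: "finprod M (\<lambda>i. ?z i [^]\<^bsub>M\<^esub> e i) {n..2*n} = \<zero>"
    using primitive_relation[of "{n..2*n}" ?z p] zA p by auto
  obtain j where j: "j \<in> {n..2*n}" "\<not> p dvd e j"
      and small: "\<And>i. i \<in> {n..2*n} \<Longrightarrow> i < j \<Longrightarrow> p dvd e i"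
    using e exists_least_iff[of "\<lambda>i. i \<in> {n..2*n} \<and> \<not> p dvd e i"] by blast
  note K = ideal_multiples[OF zA[of j]]
  have large: "?z i \<in> multiples (?z j)" if "j < i" for i
    using that z star_prod_multiple by simp
  have others: "?z i [^]\<^bsub>M\<^esub> e i \<in> multiples (?z j)" if i: "i \<in> {n..2*n}" "i \<noteq> j" for i
  proof -
    have "?z i \<star> ?z i \<in> multiples (?z j)"
      using i j large[of "i + i + 1"] by (simp only: star_prod_const_mult[OF z]) simp
    moreover have "e i \<cdot> ?z i \<in> multiples (?z j)"
    proof (cases "i < j")
      case True
      then obtain q where "e i = p * q" using small i by blast
      then have "e i \<cdot> ?z i = q \<cdot> (p \<cdot> ?z i)" using zA by (simp add: additive.int_pow_pow)
      then show ?thesis using pz' ideal_zero_mem[OF K] by simp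
    next
      case False
      then show ?thesis using i large[of i] ideal_scale[OF K] by simp
    qed
    ultimately show ?thesis using pow_mem_ideal[OF K zA] by blast
  qed
  obtain u where u: "u \<in> A" "e j \<cdot> ?z j = ?z j \<star> u"
    using leading_term_of_relation[of "{n..2*n}" j ?z e] j zA others rel by auto
  \<comment> \<open>Since \<open>p\<close> kills the power and \<open>e j\<close> is invertible modulo \<open>p\<close>, the power is a multiple of itself.\<close>
  have "coprime p (e j)" using p j(2) by (simp add: prime_imp_coprime)
  then obtain s t where st: "s * p + t * e j = 1"
    by (metis bezout_int coprime_imp_gcd_eq_1)
  have "?z j = (p * s + e j * t) \<cdot> ?z j"
    using st zA by (simp add: additive.int_pow_1 mult.commute)
  also have "\<dots> = s \<cdot> (p \<cdot> ?z j) \<boxplus> t \<cdot> (e j \<cdot> ?z j)"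
    using zA by (simp add: additive.int_pow_mult additive.int_pow_pow)
  also have "\<dots> = ?z j \<star> (t \<cdot> u)"
    using zA u by (simp add: pz' star_scale)
  finally have "?z j = \<zero>" using eq_zero_of_eq_star zA u additive.int_pow_closed by blast
  \<comment> \<open>So \<open>z\<close> is nilpotent. If \<open>z\<^sup>k\<^sup>+\<^sup>2 = 0\<close>, then \<open>z\<^sup>k\<^sup>+\<^sup>1\<close> has square zero and vanishes too; this
      lowers the exponent to 1.\<close>
  then show ?thesis
  proof (induction j)
    case (Suc k)
    have "?z k \<star> ?z k = \<zero>"
      using Suc.prems star_prod_const_mult[OF z, of k k] star_prod_multiple[of "\<lambda>_. z" "Suc k" "k+k+1"]
        z by (cases "k = 0") (auto simp: multiples_def)
    then have "?z k = \<zero>"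
      using square_zero_torsion_trivial[OF zA pz'] p by auto
    then show ?case by (rule Suc.IH)
  qed simp
qed

lemma additive_torsion_free:
  assumes "x \<in> A" "d \<cdot> x = \<zero>" "d \<noteq> 0"
  shows "x = \<zero>"
  using assms(3,1,2)
proof (induction d arbitrary: x rule: prime_divisors_induct)
  case zero
  then show ?case by simp
next
  case (unit d)
  then have "d = 1 \<or> d = -1" by auto
  then show ?case using unit additive.int_pow_neg[of x 1]
    by (auto simp: additive.int_pow_1 additive.inv_eq_1_iff)
next
  case (factor p d)
  have "d \<cdot> (p \<cdot> x) = \<zero>" using factor.prems by (simp add: additive.int_pow_pow)
  then have "p \<cdot> x = \<zero>" using factor by simp
  then show ?case using no_prime_torsion factor by blast
qed

text \<open>Since \<open>u\<close> acts on \<open>y\<close> as the integer \<open>c\<close>, the integers congruent to 1 modulo \<open>c\<close> act on \<open>y\<close>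
  as group elements. A relation between \<open>n + 1\<close> pairwise coprime ones yields a nonzero integer
  that annihilates \<open>y\<close>.\<close>

lemma integer_multiple_in_radical:
  assumes y: "y \<in> A" and u: "u \<in> A" and cy: "c \<cdot> y = y \<star> u" and "c > 0"
  shows "y = \<zero>"
proof -
  let ?I = "{1..Suc n}"
  define m where "m = (\<lambda>i. 1 + int i * (c * fact (Suc n)))"
  define g where "g = (\<lambda>i. (int i * fact (Suc n)) \<cdot> u)"
  have gA: "g i \<in> A" for i using u by (simp add: g_def)
  have act: "y \<boxplus> g i \<star> y = m i \<cdot> y" for i
  proof -
    have "g i \<star> y = (int i * fact (Suc n)) \<cdot> (c \<cdot> y)"
      unfolding g_def using y u star_comm[of u y] cy by (simp only: scale_star)
    also have "\<dots> = (int i * (c * fact (Suc n))) \<cdot> y"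
      using y by (simp add: additive.int_pow_pow mult.commute mult.left_commute)
    finally show ?thesis
      using y additive.int_pow_mult[of y 1] by (simp add: m_def additive.int_pow_1)
  qed
  obtain e :: "nat \<Rightarrow> int" where e: "\<exists>i\<in>?I. e i \<noteq> 0"
      and rel: "finprod M (\<lambda>i. g i [^]\<^bsub>M\<^esub> e i) ?I = \<zero>"
    using dependent[of ?I g] gA by auto
  \<comment> \<open>Moving the negative exponents to the other side leaves only natural powers, whose action on
      \<open>y\<close> is by an integer.\<close>
  define pos where "pos = (\<lambda>i. nat (e i))"
  define neg where "neg = (\<lambda>i. nat (- e i))"
  have pi: "(\<lambda>i. g i [^]\<^bsub>M\<^esub> (f i::nat)) \<in> ?I \<rightarrow> carrier M" for f using gA by auto
  have pi': "(\<lambda>i. g i [^]\<^bsub>M\<^esub> (f i::int)) \<in> ?I \<rightarrow> carrier M" for f using gA by auto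
  have "finprod M (\<lambda>i. g i [^]\<^bsub>M\<^esub> pos i) ?I
      = finprod M (\<lambda>i. g i [^]\<^bsub>M\<^esub> e i \<odot> g i [^]\<^bsub>M\<^esub> neg i) ?I"
  proof (rule multiplicative.finprod_cong')
    fix i
    have "g i [^]\<^bsub>M\<^esub> pos i = g i [^]\<^bsub>M\<^esub> (e i + int (neg i))"
      unfolding int_pow_int[symmetric] by (simp add: pos_def neg_def)
    also have "\<dots> = g i [^]\<^bsub>M\<^esub> e i \<odot> g i [^]\<^bsub>M\<^esub> neg i"
      using gA by (simp add: multiplicative.int_pow_mult int_pow_int)
    finally show "g i [^]\<^bsub>M\<^esub> pos i = g i [^]\<^bsub>M\<^esub> e i \<odot> g i [^]\<^bsub>M\<^esub> neg i" .
  qed (use gA in auto)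
  also have "\<dots> = finprod M (\<lambda>i. g i [^]\<^bsub>M\<^esub> neg i) ?I"
    using multiplicative.finprod_multf[OF pi' pi] rel multiplicative.finprod_closed[OF pi] by simp
  finally have eq: "finprod M (\<lambda>i. g i [^]\<^bsub>M\<^esub> pos i) ?I
      = finprod M (\<lambda>i. g i [^]\<^bsub>M\<^esub> neg i) ?I" .
  have acts: "y \<boxplus> finprod M (\<lambda>i. g i [^]\<^bsub>M\<^esub> (f i::nat)) ?I \<star> y = (\<Prod>i\<in>?I. m i ^ f i) \<cdot> y" for f
    using y gA act by (intro finprod_acts_as_integer natpow_acts_as_integer) auto
  define S T where "S = (\<Prod>i\<in>?I. m i ^ pos i)" and "T = (\<Prod>i\<in>?I. m i ^ neg i)"
  have ST: "S \<cdot> y = T \<cdot> y" using acts[of pos] acts[of neg] eq by (simp add: S_def T_def)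
  have "S \<noteq> T"
  proof
    assume "S = T"
    obtain j where j: "j \<in> ?I" "e j \<noteq> 0" using e by blast
    have mj: "m j > 1" using j \<open>c > 0\<close> by (simp add: m_def)
    have cop: "coprime (m j) (\<Prod>i\<in>?I. m i ^ f i)" if "f j = 0" for f
    proof (rule prod_coprime_right)
      fix i assume "i \<in> ?I"
      then show "coprime (m j) (m i ^ f i)"
        using that j coprime_beta_sequence[of j "Suc n" i c]
        by (cases "i = j") (auto simp: m_def simp del: fact_Suc)
    qed
    have dvd: "m j dvd (\<Prod>i\<in>?I. m i ^ f i)" if "f j > 0" for f
      using that j by (meson dvd_prodI dvd_power dvd_trans finite_atLeastAtMost)
    have "coprime (m j) S \<and> m j dvd S"
    proof (cases "e j > 0")
      case True
      then have "m j dvd S" "coprime (m j) T"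
        unfolding S_def T_def using dvd[of pos] cop[of neg] by (simp_all only: pos_def neg_def)
      then show ?thesis using \<open>S = T\<close> by simp
    next
      case False
      then have "m j dvd T" "coprime (m j) S"
        unfolding S_def T_def using dvd[of neg] cop[of pos] j(2)
        by (simp_all only: pos_def neg_def)
      then show ?thesis using \<open>S = T\<close> by simp
    qed
    then have "is_unit (m j)" by (meson coprime_absorb_left)
    then show False using mj by simp
  qed
  moreover have "(S - T) \<cdot> y = \<zero>"
    using ST y by (simp add: additive.int_pow_diff)
  ultimately show ?thesis using additive_torsion_free[OF y] by simp
qed

section \<open>Vanishing of products of length \<open>n + 1\<close>\<close>

lemma star_prod_vanishes:
  assumes x: "\<And>i. x i \<in> A"
  shows "star_prod x n = \<zero>"
proof -
  let ?y = "star_prod x"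
  have yA: "?y i \<in> A" for i using x by simp
  obtain e :: "nat \<Rightarrow> int" where e: "\<exists>i\<in>{..n}. e i \<noteq> 0"
      and rel: "finprod M (\<lambda>i. ?y i [^]\<^bsub>M\<^esub> e i) {..n} = \<zero>"
    using dependent[of "{..n}" ?y] yA by auto
  obtain j where j: "j \<le> n" "e j \<noteq> 0"
      and small: "\<And>i. i \<le> n \<Longrightarrow> i < j \<Longrightarrow> e i = 0"
    using e exists_least_iff[of "\<lambda>i. i \<in> {..n} \<and> e i \<noteq> 0"] by auto
  note K = ideal_multiples[OF yA[of j]]
  have others: "?y i [^]\<^bsub>M\<^esub> e i \<in> multiples (?y j)" if i: "i \<in> {..n}" "i \<noteq> j" for i
  proof (cases "i < j")
    case True
    then show ?thesis using small i ideal_zero_mem[OF K] by simp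
  next
    case False
    then have 1: "?y i \<in> multiples (?y j)" using i x star_prod_multiple by simp
    then have "?y i \<star> ?y i \<in> multiples (?y j)" using ideal_star[OF K] yA by blast
    then show ?thesis using pow_mem_ideal[OF K yA] ideal_scale[OF K 1] by blast
  qed
  obtain u where u: "u \<in> A" "e j \<cdot> ?y j = ?y j \<star> u"
    using leading_term_of_relation[of "{..n}" j ?y e] j yA others rel by auto
  have "?y j = \<zero>"
  proof (cases "e j > 0")
    case True
    then show ?thesis using integer_multiple_in_radical[OF yA[of j] u] by simp
  next
    case False
    have "(- e j) \<cdot> ?y j = ?y j \<star> (\<boxminus> u)"
      using u yA by (simp add: additive.int_pow_neg star_neg)
    then show ?thesis
      using False j u integer_multiple_in_radical[OF yA[of j], of "\<boxminus> u" "- e j"] by simp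
  qed
  then show ?thesis
    using j(1) x star_prod_multiple[of x j n] by (cases "j = n") (auto simp: multiples_def)
qed

lemma right_series_trivial: "right_series P M (Suc n) = {\<zero>}"
proof -
  have "{star_prod x n | x. \<forall>i. x i \<in> A} \<subseteq> {\<zero>}" using star_prod_vanishes by auto
  then have "generate P {star_prod x n | x. \<forall>i. x i \<in> A} \<subseteq> {\<zero>}"
    using additive.generate_subgroup_incl additive.triv_subgroup by blast
  moreover have "\<zero> \<in> right_series P M (Suc n)"
    by (cases n) (auto simp: brace_star_set_def generate.one)
  ultimately show ?thesis using right_series_star_prod[of n] by blast
qed

end

section \<open>Transfer from free abelian groups\<close>

lemma hom_int_functions_finprod:
  assumes "comm_group M" "h \<in> hom M (product_group K (\<lambda>_. integer_group))"
    and "finite I" "\<And>i. i \<in> I \<Longrightarrow> a i \<in> carrier M" "k \<in> K"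
  shows "h (finprod M (\<lambda>i. a i [^]\<^bsub>M\<^esub> (e i::int)) I) k = (\<Sum>i\<in>I. e i * h (a i) k)"
proof -
  interpret M: comm_group M by fact
  let ?f = "\<lambda>x. h x k"
  have "?f \<in> hom M integer_group"
    using assms(2,5) by (auto simp: hom_def)
  then interpret f: group_hom M integer_group ?f
    by (simp add: group_hom_def group_hom_axioms_def M.is_group)
  show ?thesis using assms(3,4)
  proof (induction I)
    case empty
    then show ?case using f.hom_one by simp
  next
    case (insert i I)
    then have "finprod M (\<lambda>i. a i [^]\<^bsub>M\<^esub> e i) (insert i I)
        = a i [^]\<^bsub>M\<^esub> e i \<otimes>\<^bsub>M\<^esub> finprod M (\<lambda>i. a i [^]\<^bsub>M\<^esub> e i) I"
      by (intro M.finprod_insert) auto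
    moreover have "?f (a i [^]\<^bsub>M\<^esub> e i) = e i * ?f (a i)"
      using insert.prems f.hom_int_pow[of "a i" "e i"] by simp
    moreover have "finprod M (\<lambda>i. a i [^]\<^bsub>M\<^esub> e i) I \<in> carrier M"
      using insert.prems by (intro M.finprod_closed) auto
    ultimately show ?case
      using insert f.hom_mult[of "a i [^]\<^bsub>M\<^esub> e i" "finprod M (\<lambda>i. a i [^]\<^bsub>M\<^esub> e i) I"] by simp
  qed
qed

lemma (in group) comm_group_if_iso_int_functions:
  assumes h: "h \<in> iso G (product_group K (\<lambda>_. integer_group))"
  shows "comm_group G"
proof (rule group_comm_groupI)
  fix x y assume xy: "x \<in> carrier G" "y \<in> carrier G"
  have "h \<in> hom G (product_group K (\<lambda>_. integer_group))" using h by (simp add: iso_def)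
  note mult = hom_mult[OF this]
  have "h (x \<otimes> y) = h (y \<otimes> x)" using xy by (simp add: mult add.commute)
  then show "x \<otimes> y = y \<otimes> x"
    using h xy by (auto simp: iso_def bij_betw_def dest: inj_onD)
qed

theorem proposition4p2:
  fixes P :: "('a, 'b) monoid_scheme" and M :: "('a, 'c) monoid_scheme" and n :: nat
  assumes "n > 0"
    and "brace P M"
    and "M \<cong> product_group {..<n} (\<lambda>_. integer_group)"
  shows "right_nilpotent P M \<and> right_nilpotency_class P M \<le> n"
proof -
  interpret brace P M by fact
  let ?Z = "product_group {..<n} (\<lambda>_. integer_group)"
  obtain h where h: "h \<in> iso M ?Z" using assms(3) by (auto simp: is_iso_def)
  then have hom: "h \<in> hom M ?Z" and inj: "inj_on h (carrier M)"
    by (auto simp: iso_def bij_betw_def)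
  have M: "comm_group M" using multiplicative.comm_group_if_iso_int_functions[OF h] .
  interpret comm_brace P M using assms(2) M by (simp add: comm_brace_def)
  have trivial: "x = \<one>\<^bsub>P\<^esub>" if x: "x \<in> A" "\<And>k. k < n \<Longrightarrow> h x k = 0" for x
  proof -
    have "h x \<in> carrier ?Z" using hom x(1) by (auto simp: hom_def)
    then have "h x = \<one>\<^bsub>?Z\<^esub>" using x(2) by (auto simp: PiE_iff extensional_def)
    also have "\<dots> = h \<one>\<^bsub>M\<^esub>"
      using hom_one[OF hom multiplicative.is_group] by simp
    finally show ?thesis using inj_onD[OF inj] x(1) by simp
  qed
  interpret finite_rank_brace P M n
  proof
    fix I :: "nat set" and a
    assume I: "finite I" "card I > n" "\<And>i. i \<in> I \<Longrightarrow> a i \<in> A"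
    obtain e where e: "\<exists>i\<in>I. e i \<noteq> 0" "\<forall>k<n. (\<Sum>i\<in>I. e i * h (a i) k) = 0"
      using int_vectors_dependent[OF I(1,2), of "\<lambda>i. h (a i)"] by blast
    have "finprod M (\<lambda>i. a i [^]\<^bsub>M\<^esub> e i) I = \<one>\<^bsub>P\<^esub>"
    proof (rule trivial)
      show "finprod M (\<lambda>i. a i [^]\<^bsub>M\<^esub> e i) I \<in> A"
        using multiplicative.finprod_closed[of "\<lambda>i. a i [^]\<^bsub>M\<^esub> e i" I] I(3) by auto
      show "h (finprod M (\<lambda>i. a i [^]\<^bsub>M\<^esub> e i) I) k = 0" if "k < n" for k
        using hom_int_functions_finprod[OF M hom I(1), of a k e] I(3) e(2) that by simp
    qed
    with e(1) show "\<exists>e :: nat \<Rightarrow> int. (\<exists>i\<in>I. e i \<noteq> 0) \<and>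
        finprod M (\<lambda>i. a i [^]\<^bsub>M\<^esub> e i) I = \<one>\<^bsub>P\<^esub>" by blast
  next
    fix x and d :: int
    assume x: "x \<in> A" "x [^]\<^bsub>M\<^esub> d = \<one>\<^bsub>P\<^esub>" "d \<noteq> 0"
    show "x = \<one>\<^bsub>P\<^esub>"
    proof (rule trivial[OF x(1)])
      fix k assume "k < n"
      moreover have "h \<one>\<^bsub>M\<^esub> = \<one>\<^bsub>?Z\<^esub>" using hom_one[OF hom multiplicative.is_group] by simp
      ultimately have "d * h x k = 0"
        using hom_int_functions_finprod[OF M hom, of "{0::nat}" "\<lambda>_. x" k "\<lambda>_. d"] x by simp
      then show "h x k = 0" using x(3) by simp
    qed
  qed
  have "right_series P M (Suc n) = {\<one>\<^bsub>P\<^esub>}" by (rule right_series_trivial)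
  then show ?thesis
    unfolding right_nilpotent_def right_nilpotency_class_def
    by (auto intro!: exI[of _ "Suc n"] simp: le_diff_conv intro: Least_le)
qed

end
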